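(* Let $\mathbf{t}(t)$ be a rational unit vector field in $\mathbb{R}^3$ which traces a small circle on the unit sphere $S^2$, with $\mathbf{t}'(t)\neq 0$ for all $t$, and let $\mathbf{u}$, $\psi$, $\mathbf{w}_2(t)$, $\mathbf{w}_3(t)$ be the constant unit vector, the constant angle and the vector fields associated with $\mathbf{t}(t)$ (see context). Let $\mathbf{r}(t)$ be a rational helix. Then $\mathbf{t}(t)$ is tangent to $\mathbf{r}(t)$ if and only if there exists a rational function $a_3(t)$ such that $$\mathbf{r}(t)=a_1(t)\,\mathbf{t}(t)+a_2(t)\,\mathbf{w}_2(t)+a_3(t)\,\mathbf{w}_3(t),$$ where $a_2(t)$ and $a_1(t)$ are obtained from (i.e. satisfy), respectively, the equations $$a_2(t)\,\cot\psi\,\csc\psi\,\det(\mathbf{u},\mathbf{t}(t),\mathbf{t}'(t))+a_3'(t)=0$$ and $$a_2'(t)+\bigl(a_1(t)-\cot\psi\,a_3(t)\bigr)\csc\psi\,\det(\mathbf{u},\mathbf{t}(t),\mathbf{t}'(t))=0.$$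
   Context: All functions are functions of a real parameter $t$ (ranging over an interval on which they are defined), and $'$ denotes $d/dt$. A rational function, vector field or curve has (component) functions that are quotients of real polynomials in $t$. A rational helix is a rational curve in $\mathbb{R}^3$ whose unit tangent makes a constant angle with some fixed direction. A small circle is a circle on $S^2$ (intersection of $S^2$ with a plane, not a single point) that is not a great circle. For a unit vector field $\mathbf{t}(t)$ tracing a small circle, $\mathbf{u}$ denotes a constant unit vector (in the direction of $\mathbf{t}'\times\mathbf{t}''$, i.e. normal to the plane of the circle) and $\psi\in(0,\pi)$ the constant angle with $\mathbf{t}(t)\cdot\mathbf{u}=\cos\psi$ for all $t$. Put $$\mathbf{w}_2(t)=\frac{1}{\sin\psi}\,\mathbf{u}\times\mathbf{t}(t),\qquad \mathbf{w}_3(t)=\mathbf{t}(t)\times\mathbf{w}_2(t)=\frac{1}{\sin\psi}\bigl(\mathbf{u}-\cos\psi\,\mathbf{t}(t)\bigr),$$ so that $(\mathbf{t},\mathbf{w}_2,\mathbf{w}_3)$ is an orthonormal basis of $\mathbb{R}^3$ for each $t$. The field $\mathbf{t}(t)$ is tangent to $\mathbf{r}(t)$ if $\mathbf{r}'(t)=\sigma(t)\,\mathbf{t}(t)$ for some rational function $\sigma(t)$. *)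

theory Defs
  imports "HOL-Analysis.Analysis" "HOL-Computational_Algebra.Polynomial"
begin

unbundle cross3_syntax

text \<open>
  Functions of the real parameter are total functions of which only the restriction to a
  nondegenerate interval \<open>I\<close> matters; the interval may be open, closed or unbounded, so derivatives
  are taken within \<open>I\<close> (one-sided at an end point that belongs to \<open>I\<close>).
\<close>

definition nondegenerate_interval :: "real set \<Rightarrow> bool" where
  "nondegenerate_interval I \<longleftrightarrow> is_interval I \<and> interior I \<noteq> {}"

abbreviation deriv_on :: "real set \<Rightarrow> (real \<Rightarrow> 'a::real_normed_vector) \<Rightarrow> real \<Rightarrow> 'a" where
  "deriv_on I f t \<equiv> vector_derivative f (at t within I)"

definition rational_on :: "real set \<Rightarrow> (real \<Rightarrow> real) \<Rightarrow> bool" where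
  "rational_on I f \<longleftrightarrow>
     (\<exists>p q :: real poly. \<forall>t\<in>I. poly q t \<noteq> 0 \<and> f t = poly p t / poly q t)"

definition rational_curve_on :: "real set \<Rightarrow> (real \<Rightarrow> real^3) \<Rightarrow> bool" where
  "rational_curve_on I r \<longleftrightarrow> (\<forall>i. rational_on I (\<lambda>t. r t $ i))"

definition rational_unit_field_on :: "real set \<Rightarrow> (real \<Rightarrow> real^3) \<Rightarrow> bool" where
  "rational_unit_field_on I T \<longleftrightarrow> rational_curve_on I T \<and> (\<forall>t\<in>I. norm (T t) = 1)"

definition spherical_circle :: "(real^3) set \<Rightarrow> bool" where
  "spherical_circle C \<longleftrightarrow>
     (\<exists>n d. n \<noteq> 0 \<and> C = sphere 0 1 \<inter> {x. n \<bullet> x = d}) \<and> C \<noteq> {} \<and> (\<forall>x. C \<noteq> {x})"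

definition great_circle :: "(real^3) set \<Rightarrow> bool" where
  "great_circle C \<longleftrightarrow> (\<exists>n. n \<noteq> 0 \<and> C = sphere 0 1 \<inter> {x. n \<bullet> x = 0})"

definition small_circle :: "(real^3) set \<Rightarrow> bool" where
  "small_circle C \<longleftrightarrow> spherical_circle C \<and> \<not> great_circle C"

text \<open>A rational field on \<open>I\<close> need not run through the whole circle (a rational parametrization
  generally misses a point), so only containment is required.\<close>

definition traces_small_circle_on :: "real set \<Rightarrow> (real \<Rightarrow> real^3) \<Rightarrow> bool" where
  "traces_small_circle_on I T \<longleftrightarrow> (\<exists>C. small_circle C \<and> T ` I \<subseteq> C)"

text \<open>The constant unit normal \<open>u\<close> of the plane of the circle and the constant angle \<open>\<psi>\<close> between \<open>u\<close>
  and \<open>T\<close>. Both orientations of \<open>u\<close> along the line spanned by \<open>T' \<times> T''\<close> are allowed.\<close>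

definition axis_and_angle_on ::
    "real set \<Rightarrow> (real \<Rightarrow> real^3) \<Rightarrow> real^3 \<Rightarrow> real \<Rightarrow> bool" where
  "axis_and_angle_on I T u \<psi> \<longleftrightarrow>
     norm u = 1 \<and> 0 < \<psi> \<and> \<psi> < pi \<and>
     (\<forall>t\<in>I. \<exists>c. c \<noteq> 0 \<and> deriv_on I T t \<times> deriv_on I (deriv_on I T) t = c *\<^sub>R u) \<and>
     (\<forall>t\<in>I. T t \<bullet> u = cos \<psi>)"

definition w2 :: "real^3 \<Rightarrow> real \<Rightarrow> (real \<Rightarrow> real^3) \<Rightarrow> real \<Rightarrow> real^3" where
  "w2 u \<psi> T t = (1 / sin \<psi>) *\<^sub>R (u \<times> T t)"

definition w3 :: "real^3 \<Rightarrow> real \<Rightarrow> (real \<Rightarrow> real^3) \<Rightarrow> real \<Rightarrow> real^3" where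
  "w3 u \<psi> T t = T t \<times> w2 u \<psi> T t"

lemma w3_eq:
  assumes "norm (T t) = 1" "T t \<bullet> u = cos \<psi>"
  shows "w3 u \<psi> T t = (1 / sin \<psi>) *\<^sub>R (u - cos \<psi> *\<^sub>R T t)"
proof -
  have "T t \<bullet> T t = 1"
    using assms(1) by (simp add: dot_square_norm)
  then show ?thesis
    using assms(2) by (simp add: w3_def w2_def cross_mult_right Lagrange)
qed

definition csc :: "real \<Rightarrow> real" where
  "csc x = 1 / sin x"

definition det3 :: "real^3 \<Rightarrow> real^3 \<Rightarrow> real^3 \<Rightarrow> real" where
  "det3 a b c = det (vector [a, b, c] :: real^3^3)"

definition tangent_field_on :: "real set \<Rightarrow> (real \<Rightarrow> real^3) \<Rightarrow> (real \<Rightarrow> real^3) \<Rightarrow> bool" where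
  "tangent_field_on I T r \<longleftrightarrow>
     (\<exists>\<sigma>. rational_on I \<sigma> \<and> (\<forall>t\<in>I. deriv_on I r t = \<sigma> t *\<^sub>R T t))"

text \<open>The unit tangent of a curve is continuous and spans the tangent line wherever \<open>r' \<noteq> 0\<close>. For a
  regular curve it is \<open>r' / |r'|\<close> up to a global sign; for a nonconstant rational curve it extends
  uniquely, up to sign, through the isolated zeros of \<open>r'\<close> (so cusps are allowed).\<close>

definition unit_tangent_on :: "real set \<Rightarrow> (real \<Rightarrow> real^3) \<Rightarrow> (real \<Rightarrow> real^3) \<Rightarrow> bool" where
  "unit_tangent_on I r e \<longleftrightarrow>
     continuous_on I e \<and> (\<forall>t\<in>I. norm (e t) = 1) \<and>
     (\<forall>t\<in>I. \<exists>s. deriv_on I r t = s *\<^sub>R e t)"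

text \<open>The condition that \<open>r'\<close> is not identically zero excludes constant curves, which have no
  tangent direction.\<close>

definition rational_helix_on :: "real set \<Rightarrow> (real \<Rightarrow> real^3) \<Rightarrow> bool" where
  "rational_helix_on I r \<longleftrightarrow>
     rational_curve_on I r \<and> (\<exists>t\<in>I. deriv_on I r t \<noteq> 0) \<and>
     (\<exists>e v \<theta>. unit_tangent_on I r e \<and> norm v = 1 \<and> (\<forall>t\<in>I. e t \<bullet> v = cos \<theta>))"

end

theory Submission
  imports Defs
begin

text \<open>
  The two differential equations say that the velocity has no normal components. Since \<open>T\<close> is a unit
  field with \<open>T \<bullet> u\<close> constant, \<open>T'\<close> is orthogonal to both \<open>T\<close> and \<open>u\<close>, hence a multiple of \<open>w\<^sub>2\<close>:
  \<open>T' = \<kappa> w\<^sub>2\<close> with \<open>\<kappa> = csc \<psi> det (u, T, T')\<close>. As \<open>w\<^sub>2\<close> and \<open>w\<^sub>3\<close> are fixed linear expressions in \<open>u\<close>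
  and \<open>T\<close>, this determines the motion of the whole frame (\<open>frame_derivatives\<close>):
  \<open>w\<^sub>2' = \<kappa> (cot \<psi> w\<^sub>3 - T)\<close> and \<open>w\<^sub>3' = - \<kappa> cot \<psi> w\<^sub>2\<close>.

  In the orthonormal frame the coefficients of \<open>r\<close> are necessarily the inner products of \<open>r\<close> with
  \<open>T\<close>, \<open>w\<^sub>2\<close> and \<open>w\<^sub>3\<close>. Differentiating \<open>a\<^sub>2 = r \<bullet> w\<^sub>2\<close> and \<open>a\<^sub>3 = r \<bullet> w\<^sub>3\<close> by the product rule turns
  the left-hand sides of the two equations into \<open>r' \<bullet> w\<^sub>3\<close> and \<open>r' \<bullet> w\<^sub>2\<close>
  (\<open>coefficient_derivatives\<close>). Both vanish exactly when \<open>r' = (r' \<bullet> T) T\<close>. The factor \<open>r' \<bullet> T\<close> and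
  the coefficient \<open>r \<bullet> w\<^sub>3\<close> are rational, because rational functions are closed under sums, products
  and derivatives.
\<close>

section \<open>Rational functions and curves\<close>

lemma rational_on_const: "rational_on I (\<lambda>t. c)"
  unfolding rational_on_def by (intro exI[of _ "[:c:]"] exI[of _ 1]) simp

lemma rational_on_add:
  assumes "rational_on I f" "rational_on I g"
  shows "rational_on I (\<lambda>t. f t + g t)"
proof -
  obtain p q p' q' where
    "\<forall>t\<in>I. poly q t \<noteq> 0 \<and> f t = poly p t / poly q t"
    "\<forall>t\<in>I. poly q' t \<noteq> 0 \<and> g t = poly p' t / poly q' t"
    using assms unfolding rational_on_def by blast
  then show ?thesis
    unfolding rational_on_def
    by (intro exI[of _ "p * q' + p' * q"] exI[of _ "q * q'"]) (simp add: add_frac_eq)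
qed

lemma rational_on_mult:
  assumes "rational_on I f" "rational_on I g"
  shows "rational_on I (\<lambda>t. f t * g t)"
proof -
  obtain p q p' q' where
    "\<forall>t\<in>I. poly q t \<noteq> 0 \<and> f t = poly p t / poly q t"
    "\<forall>t\<in>I. poly q' t \<noteq> 0 \<and> g t = poly p' t / poly q' t"
    using assms unfolding rational_on_def by blast
  then show ?thesis
    unfolding rational_on_def
    by (intro exI[of _ "p * p'"] exI[of _ "q * q'"]) simp
qed

lemma rational_on_diff:
  assumes "rational_on I f" "rational_on I g"
  shows "rational_on I (\<lambda>t. f t - g t)"
  using rational_on_add[OF assms(1) rational_on_mult[OF rational_on_const[of I "-1"] assms(2)]]
  by simp

lemma rational_on_cong:
  assumes "rational_on I f" "\<And>t. t \<in> I \<Longrightarrow> f t = g t"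
  shows "rational_on I g"
  using assms unfolding rational_on_def by metis

lemma rational_on_has_rational_derivative:
  assumes "rational_on I f"
  obtains f' where "rational_on I f'"
    and "\<And>t. t \<in> I \<Longrightarrow> (f has_vector_derivative f' t) (at t within I)"
proof -
  obtain p q where pq: "\<And>t. t \<in> I \<Longrightarrow> poly q t \<noteq> 0"
    "\<And>t. t \<in> I \<Longrightarrow> f t = poly p t / poly q t"
    using assms unfolding rational_on_def by blast
  define f' where
    "f' t = poly (pderiv p * q - p * pderiv q) t / poly (q * q) t" for t
  have "rational_on I f'"
    unfolding rational_on_def f'_def using pq(1)
    by (intro exI[of _ "pderiv p * q - p * pderiv q"] exI[of _ "q * q"]) simp
  moreover have "(f has_vector_derivative f' t) (at t within I)" if t: "t \<in> I" for t
  proof -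
    have "((\<lambda>t. poly p t / poly q t) has_real_derivative f' t) (at t)"
      using DERIV_divide[OF poly_DERIV poly_DERIV pq(1)[OF t]] by (simp add: f'_def)
    then have "((\<lambda>t. poly p t / poly q t) has_vector_derivative f' t) (at t within I)"
      by (simp add: has_real_derivative_iff_has_vector_derivative has_vector_derivative_at_within)
    then show ?thesis
      using has_vector_derivative_transform[of t I f, OF t pq(2)] by blast
  qed
  ultimately show ?thesis ..
qed

lemma rational_curve_on_has_rational_derivative:
  assumes "rational_curve_on I r"
  obtains r' where "rational_curve_on I r'"
    and "\<And>t. t \<in> I \<Longrightarrow> (r has_vector_derivative r' t) (at t within I)"
proof -
  have "\<forall>i. \<exists>f'. rational_on I f' \<and>
      (\<forall>t\<in>I. ((\<lambda>t. r t $ i) has_vector_derivative f' t) (at t within I))"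
    using assms rational_on_has_rational_derivative unfolding rational_curve_on_def by metis
  then obtain f' where f': "\<And>i. rational_on I (f' i)"
    "\<And>i t. t \<in> I \<Longrightarrow> ((\<lambda>t. r t $ i) has_vector_derivative f' i t) (at t within I)"
    by metis
  have components: "(\<Sum>i\<in>UNIV. (x $ i) *\<^sub>R axis i 1) = x" for x :: "real^3"
    using basis_expansion[of x] by (simp add: scalar_mult_eq_scaleR)
  have "(r has_vector_derivative (\<chi> i. f' i t)) (at t within I)" if "t \<in> I" for t
  proof -
    have "((\<lambda>t. \<Sum>i\<in>UNIV. (r t $ i) *\<^sub>R (axis i 1 :: real^3)) has_vector_derivative
        (\<Sum>i\<in>UNIV. ((\<chi> i. f' i t) $ i) *\<^sub>R (axis i 1 :: real^3))) (at t within I)"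
      unfolding vec_lambda_beta
      by (intro has_vector_derivative_sum
          bounded_linear.has_vector_derivative[OF bounded_linear_scaleR_left] f' that)
    then show ?thesis
      by (simp only: components)
  qed
  moreover have "rational_curve_on I (\<lambda>t. \<chi> i. f' i t)"
    using f'(1) by (simp add: rational_curve_on_def)
  ultimately show ?thesis
    using that by blast
qed

lemma rational_curve_on_const: "rational_curve_on I (\<lambda>t. c)"
  by (simp add: rational_curve_on_def rational_on_const)

lemma rational_on_inner:
  assumes "rational_curve_on I f" "rational_curve_on I g"
  shows "rational_on I (\<lambda>t. f t \<bullet> g t)"
  using assms unfolding rational_curve_on_def inner_vec_def sum_3
  by (auto intro!: rational_on_add rational_on_mult)

lemma rational_curve_on_cross:
  assumes "rational_curve_on I f" "rational_curve_on I g"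
  shows "rational_curve_on I (\<lambda>t. f t \<times> g t)"
  using assms unfolding rational_curve_on_def forall_3 cross_components
  by (auto intro!: rational_on_diff rational_on_mult)

lemma rational_curve_on_scaleR:
  assumes "rational_on I f" "rational_curve_on I g"
  shows "rational_curve_on I (\<lambda>t. f t *\<^sub>R g t)"
  using assms unfolding rational_curve_on_def by (auto intro: rational_on_mult)

section \<open>Derivatives within a nondegenerate interval\<close>

text \<open>One-sided derivatives at end points are unique because no point of a nondegenerate interval is
  isolated in it.\<close>

lemma nondegenerate_interval_not_bot:
  assumes "nondegenerate_interval I" "t \<in> I"
  shows "at t within I \<noteq> bot"
proof -
  have "I \<noteq> {x}" for x
    using assms(1) by (auto simp: nondegenerate_interval_def)
  moreover have "connected I"
    using assms(1) by (simp add: nondegenerate_interval_def is_interval_connected)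
  ultimately have "t islimpt I"
    using connected_imp_perfect assms(2) by blast
  then show ?thesis
    by (simp add: trivial_limit_within)
qed

lemma deriv_on_eqI:
  assumes "nondegenerate_interval I" "t \<in> I" "(f has_vector_derivative d) (at t within I)"
  shows "deriv_on I f t = d"
  using assms by (intro vector_derivative_within nondegenerate_interval_not_bot)

lemma constant_inner_derivative:
  fixes f g :: "real \<Rightarrow> 'a::real_inner"
  assumes "nondegenerate_interval I" "t \<in> I"
    and "\<And>s. s \<in> I \<Longrightarrow> f s \<bullet> g s = c"
    and "(f has_vector_derivative f') (at t within I)"
    and "(g has_vector_derivative g') (at t within I)"
  shows "f t \<bullet> g' + f' \<bullet> g t = 0"
proof -
  have "((\<lambda>s. f s \<bullet> g s) has_vector_derivative f t \<bullet> g' + f' \<bullet> g t) (at t within I)"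
    by (rule bounded_bilinear.has_vector_derivative[OF bounded_bilinear_inner assms(4,5)])
  then have "((\<lambda>s. c) has_vector_derivative f t \<bullet> g' + f' \<bullet> g t) (at t within I)"
    using assms(2,3) has_vector_derivative_transform[of t I "\<lambda>s. c" "\<lambda>s. f s \<bullet> g s"] by simp
  moreover have "((\<lambda>s. c) has_vector_derivative 0) (at t within I)"
    by (rule has_vector_derivative_const)
  ultimately show ?thesis
    using deriv_on_eqI[OF assms(1,2)] by metis
qed

section \<open>The frame of a field on a circle\<close>

text \<open>The difference of the two sides is orthogonal to \<open>a\<close>, \<open>b\<close> and \<open>a \<times> b\<close>. By Lagrange's identity a
  vector orthogonal to \<open>a\<close> and \<open>b\<close> is parallel to \<open>a \<times> b\<close>, so the difference is both parallel and
  orthogonal to this nonzero vector.\<close>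

lemma orthonormal_expansion:
  fixes a b x :: "real^3"
  assumes "a \<bullet> a = 1" "b \<bullet> b = 1" "a \<bullet> b = 0"
  shows "x = (x \<bullet> a) *\<^sub>R a + (x \<bullet> b) *\<^sub>R b + (x \<bullet> (a \<times> b)) *\<^sub>R (a \<times> b)"
proof -
  have c: "(a \<times> b) \<bullet> (a \<times> b) = 1" "(a \<times> b) \<bullet> a = 0" "(a \<times> b) \<bullet> b = 0"
    "a \<bullet> (a \<times> b) = 0" "b \<bullet> (a \<times> b) = 0"
    using assms by (simp_all add: dot_cross dot_cross_self inner_commute)
  define y where "y = x - ((x \<bullet> a) *\<^sub>R a + (x \<bullet> b) *\<^sub>R b + (x \<bullet> (a \<times> b)) *\<^sub>R (a \<times> b))"
  have y: "y \<bullet> a = 0" "y \<bullet> b = 0" "y \<bullet> (a \<times> b) = 0"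
    using assms c by (simp_all add: y_def inner_diff_left inner_add_left inner_commute[of b a])
  have "y \<times> (a \<times> b) = 0"
    using y by (simp add: Lagrange)
  then have "y = 0"
    using y(3) norm_and_cross_eq_0[of y "a \<times> b"] c(1) by auto
  then show ?thesis
    by (simp add: y_def)
qed

lemma frame_orthonormal:
  assumes "norm u = 1" "norm (T t) = 1" "T t \<bullet> u = cos \<psi>" "sin \<psi> \<noteq> 0"
  shows "T t \<bullet> T t = 1" "w2 u \<psi> T t \<bullet> w2 u \<psi> T t = 1" "w3 u \<psi> T t \<bullet> w3 u \<psi> T t = 1"
    and "T t \<bullet> w2 u \<psi> T t = 0" "T t \<bullet> w3 u \<psi> T t = 0" "w2 u \<psi> T t \<bullet> w3 u \<psi> T t = 0"
proof -
  show T: "T t \<bullet> T t = 1"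
    using assms(2) by (simp add: dot_square_norm)
  have "u \<bullet> u = 1"
    using assms(1) by (simp add: dot_square_norm)
  then have "(u \<times> T t) \<bullet> (u \<times> T t) = (sin \<psi>)\<^sup>2"
    using T assms(3) by (simp add: dot_cross inner_commute sin_squared_eq
        flip: power2_eq_square)
  then show w2: "w2 u \<psi> T t \<bullet> w2 u \<psi> T t = 1"
    using assms(4) by (simp add: w2_def power2_eq_square)
  show Tw2: "T t \<bullet> w2 u \<psi> T t = 0"
    by (simp add: w2_def dot_cross_self)
  show "w3 u \<psi> T t \<bullet> w3 u \<psi> T t = 1"
    using T w2 Tw2 by (simp add: w3_def dot_cross)
  show "T t \<bullet> w3 u \<psi> T t = 0" "w2 u \<psi> T t \<bullet> w3 u \<psi> T t = 0"
    by (simp_all add: w3_def dot_cross_self)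
qed

lemma frame_expansion:
  assumes "norm u = 1" "norm (T t) = 1" "T t \<bullet> u = cos \<psi>" "sin \<psi> \<noteq> 0"
  shows "x = (x \<bullet> T t) *\<^sub>R T t + (x \<bullet> w2 u \<psi> T t) *\<^sub>R w2 u \<psi> T t + (x \<bullet> w3 u \<psi> T t) *\<^sub>R w3 u \<psi> T t"
  using orthonormal_expansion[of "T t" "w2 u \<psi> T t" x] frame_orthonormal[of u T t \<psi>, OF assms]
  by (simp add: w3_def)

text \<open>The analogue of the Frenet equations. The fields \<open>w\<^sub>2\<close> and \<open>w\<^sub>3\<close> depend on \<open>T\<close> by the constant
  affine maps \<open>x \<mapsto> csc \<psi> (u \<times> x)\<close> and \<open>x \<mapsto> csc \<psi> (u - cos \<psi> x)\<close>, so everything follows from \<open>T'\<close>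
  being a multiple of \<open>w\<^sub>2\<close>.\<close>

lemma frame_derivatives:
  fixes T :: "real \<Rightarrow> real^3"
  assumes I: "nondegenerate_interval I" "t \<in> I"
    and u: "norm u = 1"
    and T: "\<And>s. s \<in> I \<Longrightarrow> norm (T s) = 1" "\<And>s. s \<in> I \<Longrightarrow> T s \<bullet> u = cos \<psi>"
    and \<psi>: "sin \<psi> \<noteq> 0"
    and T': "(T has_vector_derivative T') (at t within I)"
  defines "\<kappa> \<equiv> csc \<psi> * det3 u (T t) T'"
  shows "(w2 u \<psi> T has_vector_derivative \<kappa> *\<^sub>R (cot \<psi> *\<^sub>R w3 u \<psi> T t - T t)) (at t within I)"
    and "(w3 u \<psi> T has_vector_derivative - (\<kappa> * cot \<psi>) *\<^sub>R w2 u \<psi> T t) (at t within I)"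
proof -
  note fr = u T(1)[OF I(2)] T(2)[OF I(2)] \<psi>
  \<comment> \<open>\<open>w\<^sub>3\<close> lies in the span of \<open>u\<close> and \<open>T\<close>, and both \<open>T \<bullet> T\<close> and \<open>T \<bullet> u\<close> are constant, so
    only the \<open>w\<^sub>2\<close> component of \<open>T'\<close> survives.\<close>
  have "T s \<bullet> T s = 1" if "s \<in> I" for s
    using T(1)[OF that] by (simp add: dot_square_norm)
  from constant_inner_derivative[OF I this T' T'] have T'T: "T' \<bullet> T t = 0"
    by (simp add: inner_commute)
  have T'u: "T' \<bullet> u = 0"
    using constant_inner_derivative[OF I T(2) T' has_vector_derivative_const] by simp
  have "T' \<bullet> w3 u \<psi> T t = 0"
    using T'T T'u by (simp add: w3_eq[of T t u \<psi>, OF fr(2,3)] inner_diff_right)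
  moreover have "T' \<bullet> w2 u \<psi> T t = \<kappa>"
    using cross_triple[of u "T t" T']
    by (simp add: \<kappa>_def csc_def det3_def w2_def dot_cross_det[symmetric] inner_commute)
  ultimately have T'_eq: "T' = \<kappa> *\<^sub>R w2 u \<psi> T t"
    using frame_expansion[of u T t \<psi> T', OF fr] T'T by simp

  \<comment> \<open>The derivative of \<open>w\<^sub>2\<close> is a multiple of \<open>u \<times> w\<^sub>2\<close>; resolving the axis in the frame evaluates
    this product.\<close>
  have u_eq: "u = cos \<psi> *\<^sub>R T t + sin \<psi> *\<^sub>R w3 u \<psi> T t"
    using \<psi> by (simp add: w3_eq[of T t u \<psi>, OF fr(2,3)])
  have "T t \<times> w2 u \<psi> T t = w3 u \<psi> T t"
    by (simp add: w3_def)
  moreover have "w3 u \<psi> T t \<times> w2 u \<psi> T t = - T t"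
    using frame_orthonormal[of u T t \<psi>, OF fr]
    by (subst cross_skew) (simp add: w3_def Lagrange inner_commute)
  ultimately have "u \<times> w2 u \<psi> T t = cos \<psi> *\<^sub>R w3 u \<psi> T t - sin \<psi> *\<^sub>R T t"
    by (subst u_eq) (simp add: cross_add_left cross_mult_left)
  then have "(1 / sin \<psi>) *\<^sub>R (u \<times> T') = \<kappa> *\<^sub>R (cot \<psi> *\<^sub>R w3 u \<psi> T t - T t)"
    using \<psi> by (simp add: T'_eq cross_mult_right cot_def scaleR_diff_right)
  moreover have "((\<lambda>s. (1 / sin \<psi>) *\<^sub>R (u \<times> T s)) has_vector_derivative
      (1 / sin \<psi>) *\<^sub>R (u \<times> T')) (at t within I)"
  proof -
    have "linear (\<lambda>x. (1 / sin \<psi>) *\<^sub>R (u \<times> x))"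
      by (rule linearI) (simp_all add: cross_add_right cross_mult_right scaleR_add_right)
    then show ?thesis
      by (intro bounded_linear.has_vector_derivative[OF _ T'])
        (simp add: linear_conv_bounded_linear)
  qed
  ultimately show "(w2 u \<psi> T has_vector_derivative \<kappa> *\<^sub>R (cot \<psi> *\<^sub>R w3 u \<psi> T t - T t))
      (at t within I)"
    by (simp add: w2_def[abs_def])

  have "((\<lambda>s. (1 / sin \<psi>) *\<^sub>R (u - cos \<psi> *\<^sub>R T s)) has_vector_derivative
      (1 / sin \<psi>) *\<^sub>R (0 - cos \<psi> *\<^sub>R T')) (at t within I)"
    by (intro bounded_linear.has_vector_derivative[OF bounded_linear_scaleR_right]
        has_vector_derivative_diff has_vector_derivative_const T')
  moreover have w3: "w3 u \<psi> T s = (1 / sin \<psi>) *\<^sub>R (u - cos \<psi> *\<^sub>R T s)" if "s \<in> I" for s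
    by (rule w3_eq[of T s u \<psi>, OF T(1)[OF that] T(2)[OF that]])
  ultimately have "(w3 u \<psi> T has_vector_derivative (1 / sin \<psi>) *\<^sub>R (0 - cos \<psi> *\<^sub>R T')) (at t within I)"
    using has_vector_derivative_transform[of t I "w3 u \<psi> T", OF I(2) w3] by blast
  then show "(w3 u \<psi> T has_vector_derivative - (\<kappa> * cot \<psi>) *\<^sub>R w2 u \<psi> T t) (at t within I)"
    by (simp add: T'_eq cot_def mult.commute)
qed

text \<open>The terms that come from the motion of the frame are exactly those by which the two
  differential equations differ from \<open>a\<^sub>2' = 0\<close> and \<open>a\<^sub>3' = 0\<close>. The equations therefore state that
  \<open>r' \<bullet> w\<^sub>2\<close> and \<open>r' \<bullet> w\<^sub>3\<close> vanish.\<close>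

lemma coefficient_derivatives:
  fixes T r :: "real \<Rightarrow> real^3"
  assumes I: "nondegenerate_interval I" "t \<in> I"
    and u: "norm u = 1"
    and T: "\<And>s. s \<in> I \<Longrightarrow> norm (T s) = 1" "\<And>s. s \<in> I \<Longrightarrow> T s \<bullet> u = cos \<psi>"
    and \<psi>: "sin \<psi> \<noteq> 0"
    and T': "(T has_vector_derivative T') (at t within I)"
    and r': "(r has_vector_derivative r') (at t within I)"
  defines "\<kappa> \<equiv> csc \<psi> * det3 u (T t) T'"
  shows "((\<lambda>s. r s \<bullet> w2 u \<psi> T s) has_vector_derivative
      r' \<bullet> w2 u \<psi> T t - (r t \<bullet> T t - cot \<psi> * (r t \<bullet> w3 u \<psi> T t)) * \<kappa>) (at t within I)"
    and "((\<lambda>s. r s \<bullet> w3 u \<psi> T s) has_vector_derivative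
      r' \<bullet> w3 u \<psi> T t - (r t \<bullet> w2 u \<psi> T t) * cot \<psi> * \<kappa>) (at t within I)"
proof -
  note w' = frame_derivatives[OF I u T \<psi> T', folded \<kappa>_def]
  show "((\<lambda>s. r s \<bullet> w2 u \<psi> T s) has_vector_derivative
      r' \<bullet> w2 u \<psi> T t - (r t \<bullet> T t - cot \<psi> * (r t \<bullet> w3 u \<psi> T t)) * \<kappa>) (at t within I)"
    using bounded_bilinear.has_vector_derivative[OF bounded_bilinear_inner r' w'(1)]
    by (simp add: inner_diff_right algebra_simps)
  show "((\<lambda>s. r s \<bullet> w3 u \<psi> T s) has_vector_derivative
      r' \<bullet> w3 u \<psi> T t - (r t \<bullet> w2 u \<psi> T t) * cot \<psi> * \<kappa>) (at t within I)"
    using bounded_bilinear.has_vector_derivative[OF bounded_bilinear_inner r' w'(2)]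
    by (simp add: algebra_simps)
qed

section \<open>Tangency in terms of the frame coefficients\<close>

theorem proposition3:
  fixes I :: "real set" and T r :: "real \<Rightarrow> real^3" and u :: "real^3" and \<psi> :: real
  assumes "nondegenerate_interval I"
    and "rational_unit_field_on I T"
    and "traces_small_circle_on I T"
    and "\<forall>t\<in>I. deriv_on I T t \<noteq> 0"
    and "axis_and_angle_on I T u \<psi>"
    and "rational_helix_on I r"
  shows "tangent_field_on I T r \<longleftrightarrow>
    (\<exists>a1 a2 a3 :: real \<Rightarrow> real.
       rational_on I a3 \<and> a2 differentiable_on I \<and>
       (\<forall>t\<in>I. r t = a1 t *\<^sub>R T t + a2 t *\<^sub>R w2 u \<psi> T t + a3 t *\<^sub>R w3 u \<psi> T t) \<and>
       (\<forall>t\<in>I. a2 t * cot \<psi> * csc \<psi> * det3 u (T t) (deriv_on I T t) + deriv_on I a3 t = 0) \<and>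
       (\<forall>t\<in>I. deriv_on I a2 t
                + (a1 t - cot \<psi> * a3 t) * csc \<psi> * det3 u (T t) (deriv_on I T t) = 0))"
proof -
  note I = assms(1)
  have T: "rational_curve_on I T" "\<And>t. t \<in> I \<Longrightarrow> norm (T t) = 1"
    using assms(2) by (auto simp: rational_unit_field_on_def)
  have u: "norm u = 1" and \<psi>: "sin \<psi> \<noteq> 0" and Tu: "\<And>t. t \<in> I \<Longrightarrow> T t \<bullet> u = cos \<psi>"
    using assms(5) sin_gt_zero[of \<psi>] by (auto simp: axis_and_angle_on_def)
  have r: "rational_curve_on I r"
    using assms(6) by (simp add: rational_helix_on_def)
  obtain T' where T': "\<And>t. t \<in> I \<Longrightarrow> (T has_vector_derivative T' t) (at t within I)"
    using rational_curve_on_has_rational_derivative[OF T(1)] by metis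
  obtain r' where r': "rational_curve_on I r'"
    "\<And>t. t \<in> I \<Longrightarrow> (r has_vector_derivative r' t) (at t within I)"
    using rational_curve_on_has_rational_derivative[OF r] by metis
  have deriv_T: "deriv_on I T t = T' t" and deriv_r: "deriv_on I r t = r' t" if "t \<in> I" for t
    using deriv_on_eqI[OF I that] T'[OF that] r'(2)[OF that] by auto
  note orthonormal = frame_orthonormal[of u T _ \<psi>, OF u T(2) Tu \<psi>]
  note expansion = frame_expansion[of u T _ \<psi>, OF u T(2) Tu \<psi>]
  have coefficients': "((\<lambda>s. r s \<bullet> w2 u \<psi> T s) has_vector_derivative r' t \<bullet> w2 u \<psi> T t
        - (r t \<bullet> T t - cot \<psi> * (r t \<bullet> w3 u \<psi> T t)) * (csc \<psi> * det3 u (T t) (T' t))) (at t within I)"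
      "((\<lambda>s. r s \<bullet> w3 u \<psi> T s) has_vector_derivative r' t \<bullet> w3 u \<psi> T t
        - (r t \<bullet> w2 u \<psi> T t) * cot \<psi> * (csc \<psi> * det3 u (T t) (T' t))) (at t within I)"
    if "t \<in> I" for t
    by (rule coefficient_derivatives[OF I that u T(2) Tu \<psi> T'[OF that] r'(2)[OF that]];
        assumption)+

  show ?thesis
  proof
    assume "tangent_field_on I T r"
    then obtain \<sigma> where \<sigma>: "\<And>t. t \<in> I \<Longrightarrow> r' t = \<sigma> t *\<^sub>R T t"
      unfolding tangent_field_on_def using deriv_r by metis
    define a1 a2 a3 where "a1 t = r t \<bullet> T t" and "a2 t = r t \<bullet> w2 u \<psi> T t"
      and "a3 t = r t \<bullet> w3 u \<psi> T t" for t
    have normal: "r' t \<bullet> w2 u \<psi> T t = 0" "r' t \<bullet> w3 u \<psi> T t = 0" if "t \<in> I" for t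
      using \<sigma>[OF that] orthonormal[OF that that] by simp_all
    have a': "(a2 has_vector_derivative
          - ((a1 t - cot \<psi> * a3 t) * (csc \<psi> * det3 u (T t) (T' t)))) (at t within I)"
        "(a3 has_vector_derivative
          - (a2 t * cot \<psi> * (csc \<psi> * det3 u (T t) (T' t)))) (at t within I)" if "t \<in> I" for t
      using coefficients'[OF that] normal[OF that]
      by (simp_all add: a1_def a2_def[abs_def] a3_def[abs_def])
    have "rational_on I a3"
      unfolding a3_def w3_def w2_def
      by (intro rational_on_inner rational_curve_on_cross rational_curve_on_scaleR r T(1)
          rational_on_const rational_curve_on_const)
    moreover have "a2 differentiable_on I"
      using a'(1) by (auto simp: differentiable_on_def has_vector_derivative_def
          intro: differentiableI)
    moreover have "r t = a1 t *\<^sub>R T t + a2 t *\<^sub>R w2 u \<psi> T t + a3 t *\<^sub>R w3 u \<psi> T t" if "t \<in> I" for t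
      unfolding a1_def a2_def a3_def by (rule expansion[OF that that])
    moreover have "a2 t * cot \<psi> * csc \<psi> * det3 u (T t) (deriv_on I T t) + deriv_on I a3 t = 0"
      "deriv_on I a2 t + (a1 t - cot \<psi> * a3 t) * csc \<psi> * det3 u (T t) (deriv_on I T t) = 0"
      if "t \<in> I" for t
      using a'[OF that, THEN deriv_on_eqI[OF I that]] deriv_T[OF that] by simp_all
    ultimately show "\<exists>a1 a2 a3. rational_on I a3 \<and> a2 differentiable_on I \<and>
       (\<forall>t\<in>I. r t = a1 t *\<^sub>R T t + a2 t *\<^sub>R w2 u \<psi> T t + a3 t *\<^sub>R w3 u \<psi> T t) \<and>
       (\<forall>t\<in>I. a2 t * cot \<psi> * csc \<psi> * det3 u (T t) (deriv_on I T t) + deriv_on I a3 t = 0) \<and>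
       (\<forall>t\<in>I. deriv_on I a2 t
                + (a1 t - cot \<psi> * a3 t) * csc \<psi> * det3 u (T t) (deriv_on I T t) = 0)"
      by blast
  next
    assume "\<exists>a1 a2 a3. rational_on I a3 \<and> a2 differentiable_on I \<and>
       (\<forall>t\<in>I. r t = a1 t *\<^sub>R T t + a2 t *\<^sub>R w2 u \<psi> T t + a3 t *\<^sub>R w3 u \<psi> T t) \<and>
       (\<forall>t\<in>I. a2 t * cot \<psi> * csc \<psi> * det3 u (T t) (deriv_on I T t) + deriv_on I a3 t = 0) \<and>
       (\<forall>t\<in>I. deriv_on I a2 t
                + (a1 t - cot \<psi> * a3 t) * csc \<psi> * det3 u (T t) (deriv_on I T t) = 0)"
    then obtain a1 a2 a3 :: "real \<Rightarrow> real" where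
      r_eq: "\<And>t. t \<in> I \<Longrightarrow> r t = a1 t *\<^sub>R T t + a2 t *\<^sub>R w2 u \<psi> T t + a3 t *\<^sub>R w3 u \<psi> T t"
      and eq3: "\<And>t. t \<in> I \<Longrightarrow>
        a2 t * cot \<psi> * csc \<psi> * det3 u (T t) (deriv_on I T t) + deriv_on I a3 t = 0"
      and eq2: "\<And>t. t \<in> I \<Longrightarrow> deriv_on I a2 t
                + (a1 t - cot \<psi> * a3 t) * csc \<psi> * det3 u (T t) (deriv_on I T t) = 0"
      by blast
    \<comment> \<open>Orthonormality forces the given coefficients on \<open>I\<close>, so their derivatives are known.\<close>
    have a: "a1 t = r t \<bullet> T t" "a2 t = r t \<bullet> w2 u \<psi> T t" "a3 t = r t \<bullet> w3 u \<psi> T t"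
      if "t \<in> I" for t
      using orthonormal[OF that that] by (simp_all add: r_eq[OF that] inner_add_right inner_commute)
    have "r' t = (r' t \<bullet> T t) *\<^sub>R T t" if t: "t \<in> I" for t
    proof -
      have "deriv_on I a2 t = r' t \<bullet> w2 u \<psi> T t
          - (a1 t - cot \<psi> * a3 t) * (csc \<psi> * det3 u (T t) (T' t))"
        using has_vector_derivative_transform[OF t a(2) coefficients'(1)[OF t]]
        by (simp add: a[OF t] deriv_on_eqI[OF I t])
      then have "r' t \<bullet> w2 u \<psi> T t = 0"
        using eq2[OF t] deriv_T[OF t] by simp
      moreover have "deriv_on I a3 t = r' t \<bullet> w3 u \<psi> T t
          - a2 t * cot \<psi> * (csc \<psi> * det3 u (T t) (T' t))"
        using has_vector_derivative_transform[OF t a(3) coefficients'(2)[OF t]]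
        by (simp add: a[OF t] deriv_on_eqI[OF I t])
      then have "r' t \<bullet> w3 u \<psi> T t = 0"
        using eq3[OF t] deriv_T[OF t] by simp
      ultimately show ?thesis
        using expansion[OF t t, of "r' t"] by simp
    qed
    then show "tangent_field_on I T r"
      unfolding tangent_field_on_def
      using rational_on_inner[OF r'(1) T(1)] deriv_r by (intro exI[of _ "\<lambda>t. r' t \<bullet> T t"]) simp
  qed
qed

end
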